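(* Let $a\in\mathbb{R}$ and consider the system $\dot x=ax+yz,\ \dot y=y+xz,\ \dot z=z-xy$ on $\mathbb{R}^3$. Then: (i) For $a>0$ there exists a unique fixed point, located at the origin, and this fixed point is globally repelling. (ii) For $a=0$ the whole $x$-axis consists of fixed points, and all other orbits tend to one of these fixed points for $t\to-\infty$ and to infinity for $t\to+\infty$. (iii) For $a<0$ there exists a unique fixed point, located at the origin; this fixed point is hyperbolic and has a one-dimensional stable manifold, namely the $x$-axis; all other orbits (that is, those not contained in the $x$-axis) tend to infinity for $t\to+\infty$.
   Context: A fixed point is globally repelling if it is globally attracting for the time-reversed flow, i.e. every orbit tends to it as $t\to-\infty$. An orbit tends to infinity if its Euclidean norm tends to $+\infty$. *)

theory Defs
  imports "HOL-Analysis.Analysis"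
begin

definition ode_solution :: "('a::real_normed_vector \<Rightarrow> 'a) \<Rightarrow> real set \<Rightarrow> (real \<Rightarrow> 'a) \<Rightarrow> bool"
  where "ode_solution f J u \<longleftrightarrow>
    open J \<and> is_interval J \<and> J \<noteq> {} \<and> (\<forall>t\<in>J. (u has_vector_derivative f (u t)) (at t))"

text \<open>Functions are total, so a solution is a pair of an open time interval \<open>J\<close> and a function
  \<open>u\<close> whose values outside \<open>J\<close> are irrelevant.  The orbits of the system are
  the solutions that cannot be extended to a larger interval; that they exist for all the times
  needed is part of the convergence notions below, not an assumption.\<close>

definition maximal_solution :: "('a::real_normed_vector \<Rightarrow> 'a) \<Rightarrow> real set \<Rightarrow> (real \<Rightarrow> 'a) \<Rightarrow> bool"
  where "maximal_solution f J u \<longleftrightarrow>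
    ode_solution f J u \<and>
    (\<forall>K v. ode_solution f K v \<and> J \<subseteq> K \<and> (\<forall>t\<in>J. v t = u t) \<longrightarrow> K = J)"

definition converges_forward :: "real set \<Rightarrow> (real \<Rightarrow> 'a::real_normed_vector) \<Rightarrow> 'a \<Rightarrow> bool"
  where "converges_forward J u p \<longleftrightarrow> (\<exists>T. {T..} \<subseteq> J) \<and> (u \<longlongrightarrow> p) at_top"

definition converges_backward :: "real set \<Rightarrow> (real \<Rightarrow> 'a::real_normed_vector) \<Rightarrow> 'a \<Rightarrow> bool"
  where "converges_backward J u p \<longleftrightarrow> (\<exists>T. {..T} \<subseteq> J) \<and> (u \<longlongrightarrow> p) at_bot"

definition escapes_forward :: "real set \<Rightarrow> (real \<Rightarrow> 'a::real_normed_vector) \<Rightarrow> bool"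
  where "escapes_forward J u \<longleftrightarrow>
    (\<exists>T. {T..} \<subseteq> J) \<and> filterlim (\<lambda>t. norm (u t)) at_top at_top"

definition fixed_point :: "('a::real_normed_vector \<Rightarrow> 'a) \<Rightarrow> 'a \<Rightarrow> bool"
  where "fixed_point f p \<longleftrightarrow> f p = 0"

definition globally_repelling :: "('a::real_normed_vector \<Rightarrow> 'a) \<Rightarrow> 'a \<Rightarrow> bool"
  where "globally_repelling f p \<longleftrightarrow>
    fixed_point f p \<and> (\<forall>J u. maximal_solution f J u \<longrightarrow> converges_backward J u p)"

definition stable_manifold :: "('a::real_normed_vector \<Rightarrow> 'a) \<Rightarrow> 'a \<Rightarrow> 'a set"
  where "stable_manifold f p =
    {q. \<exists>J u. maximal_solution f J u \<and> q \<in> u ` J \<and> converges_forward J u p}"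

definition complex_eigenvalue :: "real ^ 'n ^ 'n \<Rightarrow> complex \<Rightarrow> bool"
  where "complex_eigenvalue A l \<longleftrightarrow>
    (\<exists>v::complex ^ 'n. v \<noteq> 0 \<and> (\<chi> i j. complex_of_real (A $ i $ j)) *v v = l *s v)"

definition hyperbolic_fixed_point :: "(real ^ 'n \<Rightarrow> real ^ 'n) \<Rightarrow> real ^ 'n \<Rightarrow> bool"
  where "hyperbolic_fixed_point f p \<longleftrightarrow>
    fixed_point f p \<and> f differentiable (at p) \<and>
    (\<forall>l. complex_eigenvalue (matrix (frechet_derivative f (at p))) l \<longrightarrow> Re l \<noteq> 0)"

definition vfield :: "real \<Rightarrow> real ^ 3 \<Rightarrow> real ^ 3"
  where "vfield a p =
    vector [a * p $ 1 + p $ 2 * p $ 3, p $ 2 + p $ 1 * p $ 3, p $ 3 - p $ 1 * p $ 2]"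

definition x_axis :: "(real ^ 3) set"
  where "x_axis = {p. p $ 2 = 0 \<and> p $ 3 = 0}"

end

(* Along every orbit d/dt (y^2 + z^2) = 2 (y^2 + z^2), so y^2 + z^2 = (c e^t)^2 with c = 0 exactly on
   the x-axis.  This settles the escape to infinity for t -> +oo and the decay of y and z for
   t -> -oo.  Since |(x e^{-at})'| = |y z| e^{-at} <= c^2 e^{(2-a)t}, integration bounds x on bounded
   times, shows x -> 0 at -oo when a > 0, and shows that x converges at -oo when a = 0.  A maximal
   solution that is bounded on bounded times is global: by Picard-Lindeloef it can be prolonged
   around each of its times s by an amount that is uniform for bounded s, so its domain is closed
   as well as open. *)

theory Submission
  imports Defs
begin

section \<open>Local existence by Picard iteration\<close>

lemma norm_diff_le_of_deriv:
  fixes f :: "real \<Rightarrow> 'a::real_normed_vector"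
  assumes "convex S"
    and "\<And>t. t \<in> S \<Longrightarrow> (f has_vector_derivative f' t) (at t within S)"
    and "\<And>t. t \<in> S \<Longrightarrow> norm (f' t) \<le> B"
    and "x \<in> S" "y \<in> S"
  shows "norm (f x - f y) \<le> B * \<bar>x - y\<bar>"
proof -
  have "norm (f x - f y) \<le> B * norm (x - y)"
    using assms
    by (intro differentiable_bound[of S f "\<lambda>t h. h *\<^sub>R f' t"])
      (auto simp: has_vector_derivative_def onorm_scaleR_left onorm_id)
  then show ?thesis by simp
qed

text \<open>Banach's fixed point theorem for the Picard operator: \<open>h * M \<le> r\<close> keeps
  its values in the ball, and \<open>h * L \<le> 1/2\<close> makes it a contraction. The half-length
  \<open>h\<close> is tied only to \<open>r\<close>, \<open>M\<close> and \<open>L\<close>, not to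
  \<open>s\<close> or \<open>p\<close>; this is what later makes the prolongation uniform.\<close>

lemma picard_local_solution:
  fixes f :: "'a::euclidean_space \<Rightarrow> 'a"
  assumes lip: "L-lipschitz_on (cball p r) f"
    and M: "\<And>x. x \<in> cball p r \<Longrightarrow> norm (f x) \<le> M"
    and r: "0 \<le> r" and h: "0 < h" "h * M \<le> r" "h * L \<le> 1/2"
  shows "\<exists>v. ode_solution f {s-h<..<s+h} v \<and> v s = p"
proof -
  define I where "I = {s-h..s+h}"
  \<comment> \<open>Clamping the time to \<open>I\<close> lets the operator act on bounded
    continuous functions on the whole line, which form a complete metric space.\<close>
  define c where "c t = max (s-h) (min (s+h) t)" for t
  \<comment> \<open>The integral starts at the left end of \<open>I\<close>, so that times before
    \<open>s\<close> need no reversed bounds; \<open>Q\<close> corrects for this by subtracting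
    \<open>E g s\<close>.\<close>
  define E where "E g t = integral {s-h..t} (\<lambda>\<tau>. f (apply_bcontfun g \<tau>))" 
    for g :: "real \<Rightarrow>\<^sub>C 'a" and t
  define Q where "Q g t = p + (E g (c t) - E g s)" for g t
  define X where "X = (PiC UNIV (\<lambda>_. cball p r) :: (real \<Rightarrow>\<^sub>C 'a) set)"
  have cI: "c t \<in> I" "\<bar>c t - s\<bar> \<le> h" for t
    using h(1) by (auto simp: c_def I_def)
  have sI: "s \<in> I" using h(1) by (auto simp: I_def)
  have XD: "apply_bcontfun g t \<in> cball p r" if "g \<in> X" for g t
    using mem_PiCD[OF that[unfolded X_def]] by (simp add: Pi_iff)
  have contf: "continuous_on I (\<lambda>\<tau>. f (apply_bcontfun g \<tau>))" if "g \<in> X" for g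
    by (rule continuous_on_compose2[OF lipschitz_on_continuous_on[OF lip]]) 
      (use XD[OF that] in auto)
  have dE: "(E g has_vector_derivative f (apply_bcontfun g t)) (at t within I)" 
    if "g \<in> X" "t \<in> I" for g t
    using integral_has_vector_derivative[OF contf[OF that(1), unfolded I_def], of t] that(2)
    unfolding E_def[abs_def] I_def by simp
  have cE: "continuous_on I (E g)" if "g \<in> X" for g
    using dE[OF that] by (rule continuous_on_vector_derivative)
  have Qcb: "Q g t \<in> cball p r" if "g \<in> X" for g t
  proof -
    have "norm (E g (c t) - E g s) \<le> M * \<bar>c t - s\<bar>"
      by (rule norm_diff_le_of_deriv[of I _ "\<lambda>t. f (apply_bcontfun g t)"])
        (use dE[OF that] M XD[OF that] cI sI in \<open>auto simp: I_def\<close>)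
    also have "\<dots> \<le> M * h"
    proof (rule mult_left_mono[OF cI(2)])
      show "0 \<le> M" using order_trans[OF norm_ge_zero M[OF XD[OF that]]] .
    qed
    also have "\<dots> \<le> r" using h(2) by (simp add: mult.commute)
    finally show ?thesis 
      by (simp add: Q_def dist_norm norm_minus_commute)
  qed
  have Qb: "Q g \<in> bcontfun" if "g \<in> X" for g
  proof -
    have "continuous_on UNIV (Q g)"
      unfolding Q_def
      by (intro continuous_intros continuous_on_compose2[OF cE[OF that]])
        (use cI in \<open>auto simp: c_def intro!: continuous_intros\<close>)
    moreover have "bounded (range (Q g))"
      by (rule bounded_subset[of "cball p r"]) (use Qcb[OF that] in auto)
    ultimately show ?thesis by (simp add: bcontfun_def)
  qed
  have ap: "apply_bcontfun (Bcontfun (Q g)) = Q g" if "g \<in> X" for g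
    using Qb[OF that] by (simp add: Bcontfun_inverse)
  have L: "0 \<le> L" using lip by (rule lipschitz_on_nonneg)
  have contract: "dist (Q g1 t) (Q g2 t) \<le> 1/2 * dist g1 g2" if "g1 \<in> X" "g2 \<in> X" for g1 g2 t
  proof -
    define D where "D \<tau> = E g1 \<tau> - E g2 \<tau>" for \<tau>
    have "norm (D (c t) - D s) \<le> (L * dist g1 g2) * \<bar>c t - s\<bar>"
    proof (rule norm_diff_le_of_deriv[of I _ "\<lambda>\<tau>. f (apply_bcontfun g1 \<tau>) - f (apply_bcontfun g2 \<tau>)"])
      fix \<tau> assume "\<tau> \<in> I"
      then show "(D has_vector_derivative f (apply_bcontfun g1 \<tau>) - f (apply_bcontfun g2 \<tau>)) (at \<tau> within I)"
        unfolding D_def using that by (intro has_vector_derivative_diff dE)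
      have "norm (f (apply_bcontfun g1 \<tau>) - f (apply_bcontfun g2 \<tau>)) 
          \<le> L * dist (apply_bcontfun g1 \<tau>) (apply_bcontfun g2 \<tau>)"
        using lipschitz_onD[OF lip XD[OF that(1)] XD[OF that(2)]] by (simp add: dist_norm)
      also have "\<dots> \<le> L * dist g1 g2" by (intro mult_left_mono dist_bounded L)
      finally show "norm (f (apply_bcontfun g1 \<tau>) - f (apply_bcontfun g2 \<tau>)) \<le> L * dist g1 g2" .
    qed (use cI sI in \<open>auto simp: I_def\<close>)
    also have "\<dots> \<le> (L * dist g1 g2) * h"
      by (intro mult_left_mono cI mult_nonneg_nonneg L zero_le_dist)
    also have "\<dots> = (h * L) * dist g1 g2" by simp
    also have "\<dots> \<le> 1/2 * dist g1 g2" by (intro mult_right_mono h zero_le_dist)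
    finally show ?thesis
      by (simp add: Q_def D_def dist_norm algebra_simps)
  qed
  have "\<exists>!g\<in>X. Bcontfun (Q g) = g"
  proof (rule Banach_fix)
    show "complete X"
      unfolding complete_eq_closed X_def by (intro closed_PiC) auto
    have "const_bcontfun p \<in> X"
      using r by (simp add: X_def mem_PiC_iff const_bcontfun.rep_eq)
    then show "X \<noteq> {}" by blast
    show "(\<lambda>g. Bcontfun (Q g)) ` X \<subseteq> X"
    proof (rule image_subsetI)
      fix g assume "g \<in> X"
      from Qcb[OF this] ap[OF this] show "Bcontfun (Q g) \<in> X"
        by (simp add: X_def mem_PiC_iff)
    qed
    show "dist (Bcontfun (Q g1)) (Bcontfun (Q g2)) \<le> 1/2 * dist g1 g2" if "g1 \<in> X" "g2 \<in> X" for g1 g2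
      using contract that by (intro dist_bound) (simp add: ap)
  qed auto
  then obtain g where g: "g \<in> X" "Bcontfun (Q g) = g" by blast
  then have gQ: "apply_bcontfun g = Q g" using ap by metis
  have "((apply_bcontfun g) has_vector_derivative f (apply_bcontfun g t)) (at t)" 
    if t: "t \<in> {s-h<..<s+h}" for t
  proof -
    have "t \<in> interior I" using t by (simp add: I_def)
    then have "(E g has_vector_derivative f (apply_bcontfun g t)) (at t)"
      using dE[OF g(1), of t] at_within_interior[of t I] interior_subset[of I] by auto
    then have "((\<lambda>\<tau>. p + (E g \<tau> - E g s)) has_vector_derivative f (apply_bcontfun g t)) (at t)"
      by (auto intro!: derivative_eq_intros)
    \<comment> \<open>Inside the open interval the clamp is the identity, so there \<open>g\<close>
      agrees with the unclamped integral and inherits its derivative.\<close>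
    then show ?thesis
      by (rule has_vector_derivative_transform_within_open[OF _ _ t])
        (auto simp: gQ Q_def c_def)
  qed
  moreover have "apply_bcontfun g s = p"
    using h(1) by (simp add: gQ Q_def c_def)
  ultimately show ?thesis
    using h(1) by (intro exI[of _ "apply_bcontfun g"]) (simp add: ode_solution_def is_interval_oo)
qed

section \<open>Uniqueness, gluing and global existence\<close>

text \<open>A Gronwall argument: by Cauchy-Schwarz the derivative of \<open>w \<bullet> w\<close> is
  at most \<open>2 * L * (w \<bullet> w)\<close> in absolute value, so a suitable exponential weight
  makes the squared norm monotone in the direction from \<open>s\<close> to
  \<open>t\<close>.\<close>

lemma eq_zero_of_deriv_le:
  fixes w :: "real \<Rightarrow> 'a::real_inner"
  assumes I: "is_interval I" "s \<in> I" "t \<in> I"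
    and w: "\<And>\<tau>. \<tau> \<in> I \<Longrightarrow> (w has_vector_derivative w' \<tau>) (at \<tau>)"
    and le: "\<And>\<tau>. \<tau> \<in> closed_segment s t \<Longrightarrow> norm (w' \<tau>) \<le> L * norm (w \<tau>)"
    and "w s = 0"
  shows "w t = 0"
proof -
  have sub: "\<tau> \<in> I" if "\<tau> \<in> closed_segment s t" for \<tau>
    using that I closed_segment_subset[OF I(2,3)] by (auto simp: is_interval_convex_1)
  \<comment> \<open>The weight is left open: \<open>k = - (2 * L)\<close> serves for
    \<open>t\<close> after \<open>s\<close>, and \<open>k = 2 * L\<close> for \<open>t\<close>
    before \<open>s\<close>.\<close>
  have dw: "((\<lambda>\<tau>. w \<tau> \<bullet> w \<tau> * exp (k * \<tau>)) has_real_derivative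
      (2 * (w \<tau> \<bullet> w' \<tau>) + k * (w \<tau> \<bullet> w \<tau>)) * exp (k * \<tau>)) (at \<tau>)"
    if "\<tau> \<in> closed_segment s t" for \<tau> k
  proof -
    have "(w has_derivative (\<lambda>h. h *\<^sub>R w' \<tau>)) (at \<tau>)"
      using w[OF sub[OF that]] by (simp add: has_vector_derivative_def)
    then have "((\<lambda>\<tau>. w \<tau> \<bullet> w \<tau>) has_real_derivative 2 * (w \<tau> \<bullet> w' \<tau>)) (at \<tau>)"
      unfolding has_field_derivative_def
      by (auto intro!: derivative_eq_intros simp: inner_commute algebra_simps fun_eq_iff)
    then show ?thesis
      by (auto intro!: derivative_eq_intros simp: algebra_simps)
  qed
  have le2: "\<bar>w \<tau> \<bullet> w' \<tau>\<bar> \<le> L * (w \<tau> \<bullet> w \<tau>)" if "\<tau> \<in> closed_segment s t" for \<tau>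
  proof -
    have "\<bar>w \<tau> \<bullet> w' \<tau>\<bar> \<le> norm (w \<tau>) * norm (w' \<tau>)" by (rule Cauchy_Schwarz_ineq2)
    also have "\<dots> \<le> norm (w \<tau>) * (L * norm (w \<tau>))" using le[OF that] by (intro mult_left_mono) auto
    finally show ?thesis by (simp add: dot_square_norm power2_eq_square algebra_simps)
  qed
  have "w t \<bullet> w t \<le> 0"
  proof (cases "s \<le> t")
    case True
    have "w t \<bullet> w t * exp ((- (2 * L)) * t) \<le> w s \<bullet> w s * exp ((- (2 * L)) * s)"
    proof (rule DERIV_nonpos_imp_nonincreasing[OF True])
      fix \<tau> assume "s \<le> \<tau>" "\<tau> \<le> t"
      then have \<tau>: "\<tau> \<in> closed_segment s t" using True by (simp add: closed_segment_eq_real_ivl)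
      show "\<exists>y. ((\<lambda>\<tau>. w \<tau> \<bullet> w \<tau> * exp ((- (2 * L)) * \<tau>)) has_real_derivative y) (at \<tau>) \<and> y \<le> 0"
        by (rule exI, rule conjI, rule dw[OF \<tau>]) (use le2[OF \<tau>] in \<open>auto simp: mult_le_0_iff\<close>)
    qed
    then show ?thesis using \<open>w s = 0\<close> by (simp add: mult_le_0_iff)
  next
    case False
    then have ts: "t \<le> s" by simp
    have "w t \<bullet> w t * exp ((2 * L) * t) \<le> w s \<bullet> w s * exp ((2 * L) * s)"
    proof (rule DERIV_nonneg_imp_nondecreasing[OF ts])
      fix \<tau> assume "t \<le> \<tau>" "\<tau> \<le> s"
      then have \<tau>: "\<tau> \<in> closed_segment s t" using ts by (simp add: closed_segment_eq_real_ivl)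
      show "\<exists>y. ((\<lambda>\<tau>. w \<tau> \<bullet> w \<tau> * exp ((2 * L) * \<tau>)) has_real_derivative y) (at \<tau>) \<and> 0 \<le> y"
        by (rule exI, rule conjI, rule dw[OF \<tau>]) (use le2[OF \<tau>] in \<open>auto simp: zero_le_mult_iff\<close>)
    qed
    then show ?thesis using \<open>w s = 0\<close> by (simp add: mult_le_0_iff)
  qed
  then show ?thesis by (metis inner_gt_zero_iff not_less)
qed

text \<open>On the compact segment between \<open>s\<close> and \<open>t\<close> both solutions stay
  in one ball; its Lipschitz constant bounds the derivative of \<open>u - v\<close> by a multiple of
  \<open>u - v\<close>, which vanishes at \<open>s\<close>.\<close>

lemma ode_solution_unique:
  fixes f :: "'a::euclidean_space \<Rightarrow> 'a"
  assumes lip: "\<And>R. \<exists>L. L-lipschitz_on (cball 0 R) f"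
    and u: "ode_solution f J u" and v: "ode_solution f K v"
    and st: "s \<in> J \<inter> K" "t \<in> J \<inter> K" and "u s = v s"
  shows "u t = v t"
proof -
  have I: "is_interval (J \<inter> K)" 
    using u v by (auto simp: ode_solution_def intro: is_interval_Int)
  have sub: "closed_segment s t \<subseteq> J \<inter> K"
    using I st by (intro closed_segment_subset) (simp_all add: is_interval_convex_1)
  have du: "(u has_vector_derivative f (u \<tau>)) (at \<tau>)" if "\<tau> \<in> J \<inter> K" for \<tau>
    using u that by (simp add: ode_solution_def)
  have dv: "(v has_vector_derivative f (v \<tau>)) (at \<tau>)" if "\<tau> \<in> J \<inter> K" for \<tau>
    using v that by (simp add: ode_solution_def)
  have "continuous_on (closed_segment s t) u"
    by (rule continuous_on_vector_derivative[where f'="\<lambda>\<tau>. f (u \<tau>)"])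
      (use du sub in \<open>auto intro: has_vector_derivative_at_within\<close>)
  then have "bounded (u ` closed_segment s t)"
    by (intro compact_imp_bounded compact_continuous_image) auto
  moreover have "continuous_on (closed_segment s t) v"
    by (rule continuous_on_vector_derivative[where f'="\<lambda>\<tau>. f (v \<tau>)"])
      (use dv sub in \<open>auto intro: has_vector_derivative_at_within\<close>)
  then have "bounded (v ` closed_segment s t)"
    by (intro compact_imp_bounded compact_continuous_image) auto
  ultimately have "bounded (u ` closed_segment s t \<union> v ` closed_segment s t)" by simp
  then obtain R where R: "\<And>x. x \<in> u ` closed_segment s t \<union> v ` closed_segment s t \<Longrightarrow> norm x \<le> R"
    unfolding bounded_iff by blast
  obtain L where L: "L-lipschitz_on (cball 0 R) f" using lip by blast
  have "u t - v t = 0"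
  proof (rule eq_zero_of_deriv_le[OF I st, where w="\<lambda>\<tau>. u \<tau> - v \<tau>" and w'="\<lambda>\<tau>. f (u \<tau>) - f (v \<tau>)"])
    show "norm (f (u \<tau>) - f (v \<tau>)) \<le> L * norm (u \<tau> - v \<tau>)" if "\<tau> \<in> closed_segment s t" for \<tau>
      using lipschitz_onD[OF L, of "u \<tau>" "v \<tau>"] R that by (auto simp: dist_norm)
  qed (use du dv \<open>u s = v s\<close> in \<open>auto intro: has_vector_derivative_diff\<close>)
  then show ?thesis by simp
qed

lemma ode_solution_glue:
  fixes f :: "'a::euclidean_space \<Rightarrow> 'a"
  assumes lip: "\<And>R. \<exists>L. L-lipschitz_on (cball 0 R) f"
    and u: "ode_solution f J u" and v: "ode_solution f K v"
    and s: "s \<in> J \<inter> K" "u s = v s"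
  shows "ode_solution f (J \<union> K) (\<lambda>t. if t \<in> J then u t else v t)"
proof -
  let ?w = "\<lambda>t. if t \<in> J then u t else v t"
  have eq: "u t = v t" if "t \<in> J" "t \<in> K" for t
    using ode_solution_unique[OF lip u v s(1) _ s(2)] that by blast
  have "open J" "open K" "is_interval J" "is_interval K"
    using u v by (auto simp: ode_solution_def)
  have "(?w has_vector_derivative f (?w t)) (at t)" if "t \<in> J \<union> K" for t
  proof (cases "t \<in> J")
    case True
    with u have "(u has_vector_derivative f (u t)) (at t)" by (simp add: ode_solution_def)
    from has_vector_derivative_transform_within_open[OF this \<open>open J\<close> True, of ?w] True
    show ?thesis by simp
  next
    case False
    with that have "t \<in> K" by simp
    with v have "(v has_vector_derivative f (v t)) (at t)" by (simp add: ode_solution_def)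
    \<comment> \<open>By uniqueness the glued function equals \<open>v\<close> on all of
      \<open>K\<close>, so the derivative carries over even when \<open>t\<close> is a boundary
      point of \<open>J\<close>.\<close>
    from has_vector_derivative_transform_within_open[OF this \<open>open K\<close> \<open>t \<in> K\<close>, of ?w] False eq
    show ?thesis by auto
  qed
  moreover have "is_interval (J \<union> K)"
    using \<open>is_interval J\<close> \<open>is_interval K\<close> s by (auto simp: is_interval_connected_1 intro!: connected_Un)
  ultimately show ?thesis
    using \<open>open J\<close> \<open>open K\<close> s by (auto simp: ode_solution_def)
qed

text \<open>The a priori bound is asked for on bounded times only, since orbits may well be
  unbounded as the time tends to infinity.\<close>

lemma maximal_solution_global:
  fixes f :: "'a::euclidean_space \<Rightarrow> 'a"
  assumes lip: "\<And>R. \<exists>L. L-lipschitz_on (cball 0 R) f"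
    and u: "maximal_solution f J u"
    and bd: "\<And>b. \<exists>R. \<forall>t\<in>J. \<bar>t\<bar> \<le> b \<longrightarrow> norm (u t) \<le> R"
  shows "J = UNIV"
proof -
  have uJ: "ode_solution f J u" using u by (simp add: maximal_solution_def)
  then have J: "open J" "J \<noteq> {}" by (auto simp: ode_solution_def)
  have step: "\<exists>h>0. \<forall>s\<in>J. \<bar>s\<bar> \<le> b \<longrightarrow> {s-h<..<s+h} \<subseteq> J" for b
  proof -
    obtain R where R: "\<And>s. s \<in> J \<Longrightarrow> \<bar>s\<bar> \<le> b \<Longrightarrow> norm (u s) \<le> R" using bd by blast
    \<comment> \<open>The unit balls around all \<open>u s\<close> with
      \<open>\<bar>s\<bar> \<le> b\<close> lie in the ball of radius \<open>R + 1\<close>, so one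
      \<open>L\<close>, one \<open>M\<close> and hence one \<open>h\<close> serve all of these
      times.\<close>
    obtain L where L: "L-lipschitz_on (cball 0 (R + 1)) f" using lip by blast
    have "compact (f ` cball 0 (R + 1))"
      by (intro compact_continuous_image lipschitz_on_continuous_on[OF L]) auto
    then have "bounded (f ` cball 0 (R + 1))" by (rule compact_imp_bounded)
    then obtain M where M: "0 < M" "\<And>x. x \<in> cball 0 (R + 1) \<Longrightarrow> norm (f x) \<le> M"
      unfolding bounded_pos by auto
    have L0: "0 \<le> L" using L by (rule lipschitz_on_nonneg)
    \<comment> \<open>The two terms yield the two smallness conditions of the local existence result
      with \<open>r = 1\<close>; the summand 1 keeps the denominator positive when
      \<open>L = 0\<close>.\<close>
    define h where "h = min (1 / M) (1 / (2 * L + 1))"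
    have h: "0 < h" "h * M \<le> 1" "h * L \<le> 1/2"
    proof -
      show "0 < h" using M L0 by (simp add: h_def)
      have "h * M \<le> 1 / M * M" using M by (intro mult_right_mono) (auto simp: h_def)
      then show "h * M \<le> 1" using M by simp
      have "h * L \<le> 1 / (2 * L + 1) * L" using L0 by (intro mult_right_mono) (auto simp: h_def)
      also have "\<dots> \<le> 1/2" using L0 by (simp add: field_simps)
      finally show "h * L \<le> 1/2" .
    qed
    have "{s-h<..<s+h} \<subseteq> J" if s: "s \<in> J" "\<bar>s\<bar> \<le> b" for s
    proof -
      have sub: "cball (u s) 1 \<subseteq> cball 0 (R + 1)"
        using R[OF s] by (intro cball_subset_cball_iff[THEN iffD2]) (simp add: dist_norm)
      have "\<exists>v. ode_solution f {s-h<..<s+h} v \<and> v s = u s"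
        by (rule picard_local_solution[OF lipschitz_on_subset[OF L sub] M(2)[OF subsetD[OF sub]] _ h]) auto
      then obtain v where v: "ode_solution f {s-h<..<s+h} v" "v s = u s" by blast
      have "ode_solution f (J \<union> {s-h<..<s+h}) (\<lambda>t. if t \<in> J then u t else v t)"
        by (rule ode_solution_glue[OF lip uJ v(1)]) (use s h v in auto)
      moreover have "\<forall>t\<in>J. (if t \<in> J then u t else v t) = u t" by simp
      ultimately have "J \<union> {s-h<..<s+h} = J"
        using u Un_upper1[of J "{s-h<..<s+h}"] unfolding maximal_solution_def by blast
      then show ?thesis by blast
    qed
    with h show ?thesis by blast
  qed
  have "closed J"
    unfolding closure_subset_eq[symmetric]
  proof
    fix x assume "x \<in> closure J"
    \<comment> \<open>The bound \<open>\<bar>x\<bar> + 1\<close> covers every time within distance 1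
      of \<open>x\<close>, so \<open>h\<close> is fixed before a time \<open>s\<close> closer to
      \<open>x\<close> than \<open>h\<close> is chosen.\<close>
    obtain h where h: "h > 0" "\<And>s. s \<in> J \<Longrightarrow> \<bar>s\<bar> \<le> \<bar>x\<bar> + 1 \<Longrightarrow> {s-h<..<s+h} \<subseteq> J"
      using step[of "\<bar>x\<bar> + 1"] by blast
    obtain s where s: "s \<in> J" "dist s x < min h 1"
      using \<open>x \<in> closure J\<close>[unfolded closure_approachable, rule_format, of "min h 1"] h(1) by auto
    then have "x \<in> {s-h<..<s+h}" "\<bar>s\<bar> \<le> \<bar>x\<bar> + 1" by (auto simp: dist_real_def)
    then show "x \<in> J" using h(2) s(1) by blast
  qed
  with J show ?thesis using clopen by blast
qed

section \<open>The vector field: Lipschitz bound, distance from the axis, global orbits\<close>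

lemma vfield_nth [simp]:
  "vfield a p $ 1 = a * p $ 1 + p $ 2 * p $ 3"
  "vfield a p $ 2 = p $ 2 + p $ 1 * p $ 3"
  "vfield a p $ 3 = p $ 3 - p $ 1 * p $ 2"
  by (simp_all add: vfield_def)

lemma norm_le_sum_3: "norm (p :: real ^ 3) \<le> \<bar>p $ 1\<bar> + \<bar>p $ 2\<bar> + \<bar>p $ 3\<bar>"
  using norm_le_l1_cart[of p] by (simp add: sum_3)

text \<open>On the ball each product of two coordinates is Lipschitz with constant
  \<open>2 * \<bar>R\<bar>\<close>. The three products account for \<open>6 * \<bar>R\<bar>\<close>,
  the linear terms for \<open>\<bar>a\<bar> + 2\<close>.\<close>

lemma vfield_lipschitz: "\<exists>L. L-lipschitz_on (cball 0 R) (vfield a)"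
proof (rule exI, rule lipschitz_onI)
  fix p q :: "real ^ 3" assume pq: "p \<in> cball 0 R" "q \<in> cball 0 R"
  have d: "\<bar>p $ i - q $ i\<bar> \<le> dist p q" for i
    using component_le_norm_cart[of "p - q" i] by (simp add: dist_norm)
  have b: "\<bar>p $ i\<bar> \<le> \<bar>R\<bar>" "\<bar>q $ i\<bar> \<le> \<bar>R\<bar>" for i
    using component_le_norm_cart[of p i] component_le_norm_cart[of q i] pq by auto
  have m: "\<bar>p $ i * p $ j - q $ i * q $ j\<bar> \<le> 2 * \<bar>R\<bar> * dist p q" for i j
  proof -
    have "\<bar>p $ i * p $ j - q $ i * q $ j\<bar> = \<bar>p $ i * (p $ j - q $ j) + (p $ i - q $ i) * q $ j\<bar>"
      by (simp add: algebra_simps)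
    also have "\<dots> \<le> \<bar>p $ i\<bar> * \<bar>p $ j - q $ j\<bar> + \<bar>p $ i - q $ i\<bar> * \<bar>q $ j\<bar>"
      by (metis abs_mult abs_triangle_ineq)
    also have "\<dots> \<le> \<bar>R\<bar> * dist p q + dist p q * \<bar>R\<bar>"
      by (intro add_mono mult_mono b d) auto
    finally show ?thesis by simp
  qed
  have "\<bar>vfield a p $ 1 - vfield a q $ 1\<bar> \<le> \<bar>a\<bar> * dist p q + 2 * \<bar>R\<bar> * dist p q"
  proof -
    have "\<bar>vfield a p $ 1 - vfield a q $ 1\<bar> = \<bar>a * (p $ 1 - q $ 1) + (p $ 2 * p $ 3 - q $ 2 * q $ 3)\<bar>"
      by (simp add: algebra_simps)
    also have "\<dots> \<le> \<bar>a\<bar> * \<bar>p $ 1 - q $ 1\<bar> + \<bar>p $ 2 * p $ 3 - q $ 2 * q $ 3\<bar>"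
      by (metis abs_mult abs_triangle_ineq)
    also have "\<dots> \<le> \<bar>a\<bar> * dist p q + 2 * \<bar>R\<bar> * dist p q"
      by (intro add_mono mult_left_mono d m) auto
    finally show ?thesis .
  qed
  moreover have "\<bar>vfield a p $ 2 - vfield a q $ 2\<bar> \<le> dist p q + 2 * \<bar>R\<bar> * dist p q"
    using d[of 2] m[of 1 3] by simp
  moreover have "\<bar>vfield a p $ 3 - vfield a q $ 3\<bar> \<le> dist p q + 2 * \<bar>R\<bar> * dist p q"
    using d[of 3] m[of 1 2] by simp
  ultimately have "norm (vfield a p - vfield a q) \<le> (\<bar>a\<bar> + 2 + 6 * \<bar>R\<bar>) * dist p q"
    using norm_le_sum_3[of "vfield a p - vfield a q"] by (simp add: algebra_simps del: vfield_nth)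
  then show "dist (vfield a p) (vfield a q) \<le> (\<bar>a\<bar> + 2 + 6 * \<bar>R\<bar>) * dist p q"
    by (simp add: dist_norm)
qed auto

lemma vfield_solution_nth:
  assumes "ode_solution (vfield a) J u" "t \<in> J"
  shows "((\<lambda>t. u t $ i) has_real_derivative vfield a (u t) $ i) (at t)"
proof -
  have "(u has_vector_derivative vfield a (u t)) (at t)"
    using assms by (simp add: ode_solution_def)
  from bounded_linear.has_vector_derivative[OF bounded_linear_vec_nth this]
  show ?thesis by (simp add: has_real_derivative_iff_has_vector_derivative)
qed

text \<open>The terms \<open>x * y * z\<close> cancel in \<open>y * y' + z * z'\<close>, so
  \<open>y\<^sup>2 + z\<^sup>2\<close> times \<open>exp (- 2 * t)\<close> is constant on the
  interval; \<open>c\<close> is the square root of that constant. Thus \<open>c * exp t\<close> is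
  the distance from the x-axis.\<close>

lemma vfield_radius:
  assumes u: "ode_solution (vfield a) J u"
  shows "\<exists>c\<ge>0. \<forall>t\<in>J. (u t $ 2)\<^sup>2 + (u t $ 3)\<^sup>2 = (c * exp t)\<^sup>2"
proof -
  have J: "convex J" "J \<noteq> {}" using u by (auto simp: ode_solution_def is_interval_convex_1)
  have "((\<lambda>t. ((u t $ 2)\<^sup>2 + (u t $ 3)\<^sup>2) * exp (- 2 * t)) has_real_derivative 0) (at t within J)"
    if "t \<in> J" for t
  proof (rule has_field_derivative_at_within)
    define x y z e where "x = u t $ 1" and "y = u t $ 2" and "z = u t $ 3" and "e = exp (- 2 * t)"
    have "((\<lambda>t. (u t $ 2)\<^sup>2) has_real_derivative 2 * y * (y + x * z)) (at t)"
      using DERIV_power[OF vfield_solution_nth[OF u that, of 2], of 2] by (simp add: x_def y_def z_def mult_ac)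
    moreover have "((\<lambda>t. (u t $ 3)\<^sup>2) has_real_derivative 2 * z * (z - x * y)) (at t)"
      using DERIV_power[OF vfield_solution_nth[OF u that, of 3], of 2] by (simp add: x_def y_def z_def mult_ac)
    moreover have "((\<lambda>t. exp (- 2 * t)) has_real_derivative - 2 * e) (at t)"
      unfolding e_def by (auto intro!: derivative_eq_intros)
    ultimately have "((\<lambda>t. ((u t $ 2)\<^sup>2 + (u t $ 3)\<^sup>2) * exp (- 2 * t)) has_real_derivative
        (2 * y * (y + x * z) + 2 * z * (z - x * y)) * e + (- 2 * e) * (y\<^sup>2 + z\<^sup>2)) (at t)"
      unfolding e_def y_def z_def by (intro DERIV_mult DERIV_add)
    moreover have "(2 * y * (y + x * z) + 2 * z * (z - x * y)) * e + (- 2 * e) * (y\<^sup>2 + z\<^sup>2) = 0"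
      by (simp add: algebra_simps power2_eq_square)
    ultimately show "((\<lambda>t. ((u t $ 2)\<^sup>2 + (u t $ 3)\<^sup>2) * exp (- 2 * t)) has_real_derivative 0) (at t)"
      by (simp only:)
  qed
  then obtain k where k: "\<And>t. t \<in> J \<Longrightarrow> ((u t $ 2)\<^sup>2 + (u t $ 3)\<^sup>2) * exp (- 2 * t) = k"
    using has_field_derivative_zero_constant[OF J(1), of "\<lambda>t. ((u t $ 2)\<^sup>2 + (u t $ 3)\<^sup>2) * exp (- 2 * t)"] by auto
  obtain t0 where "t0 \<in> J" using J by blast
  then have "0 \<le> k" by (subst k[OF \<open>t0 \<in> J\<close>, symmetric]) simp
  have "(u t $ 2)\<^sup>2 + (u t $ 3)\<^sup>2 = (sqrt k * exp t)\<^sup>2" if "t \<in> J" for t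
  proof -
    have "exp (- 2 * t) * (exp t)\<^sup>2 = 1"
      by (simp only: exp_double[symmetric] exp_add[symmetric]) simp
    then have "(u t $ 2)\<^sup>2 + (u t $ 3)\<^sup>2
        = ((u t $ 2)\<^sup>2 + (u t $ 3)\<^sup>2) * (exp (- 2 * t) * (exp t)\<^sup>2)"
      by (simp only: mult_1_right)
    also have "\<dots> = k * (exp t)\<^sup>2"
      by (simp only: k[OF that] flip: mult.assoc)
    finally have "(u t $ 2)\<^sup>2 + (u t $ 3)\<^sup>2 = k * (exp t)\<^sup>2" .
    then show ?thesis
      unfolding power_mult_distrib real_sqrt_pow2[OF \<open>0 \<le> k\<close>] .
  qed
  moreover have "0 \<le> sqrt k" using \<open>0 \<le> k\<close> by simp
  ultimately show ?thesis by blast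
qed

text \<open>Controls the forcing term \<open>y * z\<close> of the first equation by the squared
  distance from the axis; the better constant 1/2 is given away.\<close>

lemma abs_prod_le_of_sum_squares:
  fixes y z :: real
  assumes "y\<^sup>2 + z\<^sup>2 = r\<^sup>2"
  shows "\<bar>y * z\<bar> \<le> r\<^sup>2"
proof -
  have "0 \<le> (\<bar>y\<bar> - \<bar>z\<bar>)\<^sup>2" by simp
  then have "2 * \<bar>y * z\<bar> \<le> r\<^sup>2" using assms by (simp add: power2_diff abs_mult)
  moreover have "0 \<le> \<bar>y * z\<bar>" by simp
  ultimately show ?thesis by linarith
qed

text \<open>The integrating factor \<open>exp (- a * t)\<close> removes the linear term of the first
  equation and leaves only the forcing.\<close>

lemma vfield_first_deriv:
  assumes "ode_solution (vfield a) J u" "t \<in> J"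
  shows "((\<lambda>t. u t $ 1 * exp (- a * t)) has_real_derivative u t $ 2 * u t $ 3 * exp (- a * t)) (at t)"
  by (auto intro!: derivative_eq_intros vfield_solution_nth[OF assms] simp: algebra_simps)

lemma vfield_maximal_global:
  assumes u: "maximal_solution (vfield a) J u"
  shows "J = UNIV"
proof (rule maximal_solution_global[OF vfield_lipschitz u])
  fix b :: real
  have sol: "ode_solution (vfield a) J u" using u by (simp add: maximal_solution_def)
  then have J: "convex J" "J \<noteq> {}" by (auto simp: ode_solution_def is_interval_convex_1)
  obtain t0 where t0: "t0 \<in> J" using J by blast
  obtain c where c: "c \<ge> 0" "\<And>t. t \<in> J \<Longrightarrow> (u t $ 2)\<^sup>2 + (u t $ 3)\<^sup>2 = (c * exp t)\<^sup>2"
    using vfield_radius[OF sol] by blast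
  \<comment> \<open>Enlarging \<open>b\<close> puts the reference time \<open>t0\<close> into the
    same convex set \<open>S\<close> as the times to be estimated.\<close>
  define B where "B = max b \<bar>t0\<bar>"
  define S where "S = J \<inter> {-B..B}"
  define E where "E t = u t $ 1 * exp (- a * t)" for t
  \<comment> \<open>\<open>D\<close> bounds the derivative of \<open>E\<close> on \<open>S\<close>:
    the first factor bounds the forcing, the second the integrating factor for either sign of
    \<open>a\<close>.\<close>
  define D where "D = (c * exp B)\<^sup>2 * exp (\<bar>a\<bar> * B)"
  have aB: "- (a * t) \<le> \<bar>a\<bar> * B" "a * t \<le> \<bar>a\<bar> * B" if "t \<in> S" for t
  proof -
    have "\<bar>a * t\<bar> \<le> \<bar>a\<bar> * B" using that by (auto simp: abs_mult S_def intro!: mult_left_mono)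
    then show "- (a * t) \<le> \<bar>a\<bar> * B" "a * t \<le> \<bar>a\<bar> * B" by linarith+
  qed
  have r: "c * exp t \<le> c * exp B" if "t \<in> S" for t
    using that c by (auto simp: S_def intro!: mult_left_mono)
  have "norm (u t) \<le> (\<bar>E t0\<bar> + D * (2 * B)) * exp (\<bar>a\<bar> * B) + c * exp B + c * exp B"
    if t: "t \<in> J" "\<bar>t\<bar> \<le> b" for t
  proof -
    have tS: "t \<in> S" "t0 \<in> S" using t t0 by (auto simp: S_def B_def)
    have "norm (E t - E t0) \<le> D * \<bar>t - t0\<bar>"
    proof (rule norm_diff_le_of_deriv[of S _ "\<lambda>t. u t $ 2 * u t $ 3 * exp (- a * t)"])
      show "convex S" using J by (auto simp: S_def intro: convex_Int)
      fix \<tau> assume \<tau>: "\<tau> \<in> S"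
      then have "\<tau> \<in> J" by (simp add: S_def)
      then show "(E has_vector_derivative u \<tau> $ 2 * u \<tau> $ 3 * exp (- a * \<tau>)) (at \<tau> within S)"
        unfolding E_def[abs_def] has_real_derivative_iff_has_vector_derivative[symmetric]
        by (rule has_field_derivative_at_within[OF vfield_first_deriv[OF sol]])
      have "\<bar>u \<tau> $ 2 * u \<tau> $ 3\<bar> \<le> (c * exp \<tau>)\<^sup>2"
        using c(2)[OF \<open>\<tau> \<in> J\<close>] by (rule abs_prod_le_of_sum_squares)
      also have "\<dots> \<le> (c * exp B)\<^sup>2"
        using r[OF \<tau>] c(1) by (intro power_mono) auto
      finally show "norm (u \<tau> $ 2 * u \<tau> $ 3 * exp (- a * \<tau>)) \<le> D"
        using aB[OF \<tau>] unfolding D_def real_norm_def abs_mult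
        by (intro mult_mono) (auto simp: abs_mult)
    qed (use tS in auto)
    moreover have "D * \<bar>t - t0\<bar> \<le> D * (2 * B)"
      using tS by (intro mult_left_mono) (auto simp: D_def S_def)
    ultimately have "\<bar>E t\<bar> \<le> \<bar>E t0\<bar> + D * (2 * B)" by simp
    moreover have "u t $ 1 = E t * exp (a * t)"
      by (simp add: E_def exp_minus)
    ultimately have "\<bar>u t $ 1\<bar> \<le> (\<bar>E t0\<bar> + D * (2 * B)) * exp (\<bar>a\<bar> * B)"
      using aB[OF tS(1)] by (simp add: abs_mult mult_mono)
    moreover have "\<bar>u t $ 2\<bar> \<le> c * exp B" "\<bar>u t $ 3\<bar> \<le> c * exp B"
    proof -
      have "(u t $ 2)\<^sup>2 \<le> (c * exp t)\<^sup>2" "(u t $ 3)\<^sup>2 \<le> (c * exp t)\<^sup>2" 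
        using c(2)[OF t(1)] zero_le_power2[of "u t $ 2"] zero_le_power2[of "u t $ 3"] by linarith+
      then have "\<bar>u t $ 2\<bar> \<le> \<bar>c * exp t\<bar>" "\<bar>u t $ 3\<bar> \<le> \<bar>c * exp t\<bar>"
        by (simp_all only: abs_le_square_iff)
      then have "\<bar>u t $ 2\<bar> \<le> c * exp t" "\<bar>u t $ 3\<bar> \<le> c * exp t"
        using c(1) by simp_all
      then show "\<bar>u t $ 2\<bar> \<le> c * exp B" "\<bar>u t $ 3\<bar> \<le> c * exp B"
        using r[OF tS(1)] by linarith+
    qed
    ultimately show ?thesis using norm_le_sum_3[of "u t"] by linarith
  qed
  then show "\<exists>R. \<forall>t\<in>J. \<bar>t\<bar> \<le> b \<longrightarrow> norm (u t) \<le> R" by blast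
qed

section \<open>Asymptotics of orbits in both time directions\<close>

text \<open>Both \<open>g - f\<close> and \<open>g + f\<close> are nondecreasing. This replaces
  integrating the bound: \<open>g\<close> is chosen as an explicit antiderivative of it.\<close>

lemma abs_diff_le_of_deriv_le:
  fixes f g :: "real \<Rightarrow> real"
  assumes "s \<le> t"
    and f: "\<And>\<tau>. s \<le> \<tau> \<Longrightarrow> \<tau> \<le> t \<Longrightarrow> (f has_real_derivative f' \<tau>) (at \<tau>)"
    and g: "\<And>\<tau>. s \<le> \<tau> \<Longrightarrow> \<tau> \<le> t \<Longrightarrow> (g has_real_derivative g' \<tau>) (at \<tau>)"
    and le: "\<And>\<tau>. s \<le> \<tau> \<Longrightarrow> \<tau> \<le> t \<Longrightarrow> \<bar>f' \<tau>\<bar> \<le> g' \<tau>"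
  shows "\<bar>f t - f s\<bar> \<le> g t - g s"
proof -
  have "g s - f s \<le> g t - f t"
  proof (rule DERIV_nonneg_imp_nondecreasing[OF \<open>s \<le> t\<close>])
    fix \<tau> assume \<tau>: "s \<le> \<tau>" "\<tau> \<le> t"
    then show "\<exists>y. ((\<lambda>\<tau>. g \<tau> - f \<tau>) has_real_derivative y) (at \<tau>) \<and> 0 \<le> y"
      using DERIV_diff[OF g f, OF \<tau> \<tau>] le[OF \<tau>] by (intro exI[of _ "g' \<tau> - f' \<tau>"]) auto
  qed
  moreover have "g s + f s \<le> g t + f t"
  proof (rule DERIV_nonneg_imp_nondecreasing[OF \<open>s \<le> t\<close>])
    fix \<tau> assume \<tau>: "s \<le> \<tau>" "\<tau> \<le> t"
    then show "\<exists>y. ((\<lambda>\<tau>. g \<tau> + f \<tau>) has_real_derivative y) (at \<tau>) \<and> 0 \<le> y"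
      using DERIV_add[OF g f, OF \<tau> \<tau>] le[OF \<tau>] by (intro exI[of _ "g' \<tau> + f' \<tau>"]) auto
  qed
  ultimately show ?thesis by linarith
qed

lemma mono_tendsto_at_bot:
  fixes f :: "real \<Rightarrow> real"
  assumes "mono f" "bdd_below (range f)"
  shows "(f \<longlongrightarrow> Inf (range f)) at_bot"
proof (rule decreasing_tendsto)
  show "\<forall>\<^sub>F t in at_bot. Inf (range f) \<le> f t"
    using assms by (auto intro!: always_eventually cInf_lower)
  fix y assume "Inf (range f) < y"
  then obtain t0 where "f t0 < y" using assms by (auto simp: cInf_less_iff)
  then have "f t < y" if "t \<le> t0" for t using monoD[OF assms(1) that] by simp
  then show "\<forall>\<^sub>F t in at_bot. f t < y" unfolding eventually_at_bot_linorder by blast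
qed

text \<open>Either coordinate is at most the distance \<open>\<bar>c\<bar> * exp t\<close> from the
  axis, which vanishes in the limit.\<close>

lemma vfield_transverse_tendsto:
  assumes "\<And>t. (u t $ 2)\<^sup>2 + (u t $ 3)\<^sup>2 = (c * exp t)\<^sup>2" "i = 2 \<or> i = 3"
  shows "((\<lambda>t. (u t :: real ^ 3) $ i) \<longlongrightarrow> 0) at_bot"
proof (rule Lim_null_comparison)
  show "((\<lambda>t. \<bar>c\<bar> * exp t) \<longlongrightarrow> 0) at_bot"
    using tendsto_mult_right_zero[OF exp_at_bot] .
  have "\<bar>u t $ i\<bar> \<le> \<bar>c * exp t\<bar>" for t
  proof -
    have "(u t $ 2)\<^sup>2 \<le> (c * exp t)\<^sup>2" "(u t $ 3)\<^sup>2 \<le> (c * exp t)\<^sup>2"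
      using assms(1)[of t] zero_le_power2[of "u t $ 2"] zero_le_power2[of "u t $ 3"] by linarith+
    then have "(u t $ i)\<^sup>2 \<le> (c * exp t)\<^sup>2" using assms(2) by auto
    then show ?thesis by (rule abs_le_square_iff[THEN iffD2])
  qed
  then show "\<forall>\<^sub>F t in at_bot. norm (u t $ i) \<le> \<bar>c\<bar> * exp t"
    by (simp add: abs_mult)
qed

lemma norm_ge_radius:
  fixes p :: "real ^ 3"
  assumes "(p $ 2)\<^sup>2 + (p $ 3)\<^sup>2 = r\<^sup>2"
  shows "r \<le> norm p"
proof (rule power2_le_imp_le)
  show "r\<^sup>2 \<le> (norm p)\<^sup>2"
    unfolding assms[symmetric] power2_norm_eq_inner inner_vec_def sum_3
    by (simp add: power2_eq_square)
qed simp

text \<open>Comparing \<open>E\<close> at \<open>t\<close> and at 0 and multiplying back by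
  \<open>exp (a * t)\<close> bounds the first coordinate by two exponentials with positive rates
  \<open>a\<close> and \<open>\<beta>\<close>.\<close>

lemma vfield_repelling:
  assumes "a > 0" and u: "maximal_solution (vfield a) J u"
  shows "converges_backward J u 0"
proof -
  have J: "J = UNIV" using u by (rule vfield_maximal_global)
  have sol: "ode_solution (vfield a) UNIV u" using u J by (simp add: maximal_solution_def)
  obtain c where c: "\<And>t. (u t $ 2)\<^sup>2 + (u t $ 3)\<^sup>2 = (c * exp t)\<^sup>2"
    using vfield_radius[OF sol] by blast
  \<comment> \<open>The rate \<open>\<beta>\<close> replaces the rate 2 of the forcing, to avoid the resonance at \<open>a = 2\<close>.\<close>
  define \<beta> where "\<beta> = min 1 (a / 2)"
  have \<beta>: "0 < \<beta>" "\<beta> < a" "\<beta> \<le> 2" using \<open>a > 0\<close> by (auto simp: \<beta>_def)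
  define k where "k = a - \<beta>"
  have "0 < k" using \<beta> by (simp add: k_def)
  define E where "E t = u t $ 1 * exp (- a * t)" for t
  \<comment> \<open>An antiderivative of the majorant \<open>c\<^sup>2 * exp (- k * t)\<close> of
    the forcing times the integrating factor; \<open>k > 0\<close> makes \<open>G\<close> negative
    or zero.\<close>
  define G where "G t = - (c\<^sup>2 / k) * exp (- k * t)" for t
  have bound: "\<bar>u t $ 1\<bar> \<le> \<bar>E 0\<bar> * exp (a * t) + c\<^sup>2 / k * exp (\<beta> * t)" if "t \<le> 0" for t
  proof -
    have "\<bar>E 0 - E t\<bar> \<le> G 0 - G t"
    proof (rule abs_diff_le_of_deriv_le[OF that])
      fix \<tau> assume \<tau>: "t \<le> \<tau>" "\<tau> \<le> 0"
      show "(E has_real_derivative u \<tau> $ 2 * u \<tau> $ 3 * exp (- a * \<tau>)) (at \<tau>)"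
        unfolding E_def[abs_def] by (rule vfield_first_deriv[OF sol]) simp
      show "(G has_real_derivative c\<^sup>2 * exp (- k * \<tau>)) (at \<tau>)"
        unfolding G_def[abs_def] using \<open>0 < k\<close>
        by (auto intro!: derivative_eq_intros simp: field_simps)
      \<comment> \<open>The slower rate \<open>\<beta> \<le> 2\<close> gives a larger exponential
        because \<open>\<tau> \<le> 0\<close>.\<close>
      have "2 * \<tau> \<le> \<beta> * \<tau>" using \<tau> \<beta> by (intro mult_right_mono_neg) auto
      then have "exp (2 * \<tau> + - a * \<tau>) \<le> exp (- k * \<tau>)" by (simp add: k_def algebra_simps)
      moreover have "(c * exp \<tau>)\<^sup>2 * exp (- a * \<tau>) = c\<^sup>2 * exp (2 * \<tau> + - a * \<tau>)"
        by (simp only: exp_add exp_double power_mult_distrib mult.assoc)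
      ultimately have "(c * exp \<tau>)\<^sup>2 * exp (- a * \<tau>) \<le> c\<^sup>2 * exp (- k * \<tau>)"
        by (simp add: mult_left_mono)
      moreover have "\<bar>u \<tau> $ 2 * u \<tau> $ 3 * exp (- a * \<tau>)\<bar> \<le> (c * exp \<tau>)\<^sup>2 * exp (- a * \<tau>)"
        unfolding abs_mult[of _ "exp _"] using abs_prod_le_of_sum_squares[OF c[of \<tau>]] by simp
      ultimately show "\<bar>u \<tau> $ 2 * u \<tau> $ 3 * exp (- a * \<tau>)\<bar> \<le> c\<^sup>2 * exp (- k * \<tau>)" by linarith
    qed
    moreover have "G 0 \<le> 0" using \<open>0 < k\<close> by (simp add: G_def)
    ultimately have "\<bar>E t\<bar> \<le> \<bar>E 0\<bar> - G t" by linarith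
    then have "\<bar>E t\<bar> * exp (a * t) \<le> (\<bar>E 0\<bar> - G t) * exp (a * t)" by simp
    moreover have "\<bar>u t $ 1\<bar> = \<bar>E t\<bar> * exp (a * t)"
      by (simp add: E_def exp_minus abs_mult)
    \<comment> \<open>Since \<open>a - k = \<beta>\<close>, the growing factor in
      \<open>- G t\<close> becomes a decaying one.\<close>
    moreover have "exp (- k * t) * exp (a * t) = exp (\<beta> * t)"
      by (simp add: k_def algebra_simps flip: exp_add)
    then have "(\<bar>E 0\<bar> - G t) * exp (a * t) = \<bar>E 0\<bar> * exp (a * t) + c\<^sup>2 / k * exp (\<beta> * t)"
      by (simp add: G_def algebra_simps)
    ultimately show ?thesis by simp
  qed
  have exp0: "((\<lambda>t. exp (b * t)) \<longlongrightarrow> 0) at_bot" if "b > 0" for b :: real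
    using that by (intro filterlim_compose[OF exp_at_bot] filterlim_tendsto_pos_mult_at_bot[OF tendsto_const]) 
      (auto simp: filterlim_ident)
  have "((\<lambda>t. u t $ 1) \<longlongrightarrow> 0) at_bot"
  proof (rule Lim_null_comparison)
    show "\<forall>\<^sub>F t in at_bot. norm (u t $ 1) \<le> \<bar>E 0\<bar> * exp (a * t) + c\<^sup>2 / k * exp (\<beta> * t)"
      using bound unfolding eventually_at_bot_linorder real_norm_def by blast
    show "((\<lambda>t. \<bar>E 0\<bar> * exp (a * t) + c\<^sup>2 / k * exp (\<beta> * t)) \<longlongrightarrow> 0) at_bot"
      by (intro tendsto_add_zero tendsto_mult_right_zero exp0 \<open>a > 0\<close> \<beta>(1))
  qed
  then have "((\<lambda>t. u t $ i) \<longlongrightarrow> (0 :: real ^ 3) $ i) at_bot" for i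
    using vfield_transverse_tendsto[OF c, of i] exhaust_3[of i] by auto
  then show ?thesis
    by (simp add: converges_backward_def J vec_tendstoI)
qed

text \<open>With \<open>a = 0\<close> the increments of the first coordinate are dominated by those
  of \<open>G\<close>. Hence that coordinate plus \<open>G\<close> is monotone and bounded below, so
  it converges at \<open>-\<infinity>\<close>, and \<open>G\<close> itself tends to zero
  there.\<close>

lemma vfield_zero_converges_backward:
  assumes u: "maximal_solution (vfield 0) J u"
  shows "\<exists>p\<in>x_axis. converges_backward J u p"
proof -
  have J: "J = UNIV" using u by (rule vfield_maximal_global)
  have sol: "ode_solution (vfield 0) UNIV u" using u J by (simp add: maximal_solution_def)
  obtain c where c: "\<And>t. (u t $ 2)\<^sup>2 + (u t $ 3)\<^sup>2 = (c * exp t)\<^sup>2"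
    using vfield_radius[OF sol] by blast
  define G where "G t = c\<^sup>2 / 2 * exp (2 * t)" for t
  have le: "\<bar>u t $ 1 - u s $ 1\<bar> \<le> G t - G s" if "s \<le> t" for s t
  proof (rule abs_diff_le_of_deriv_le[OF that])
    fix \<tau>
    show "((\<lambda>t. u t $ 1) has_real_derivative u \<tau> $ 2 * u \<tau> $ 3) (at \<tau>)"
      using vfield_first_deriv[OF sol, of \<tau>] by simp
    show "(G has_real_derivative c\<^sup>2 * exp (2 * \<tau>)) (at \<tau>)"
      unfolding G_def[abs_def] by (auto intro!: derivative_eq_intros)
    show "\<bar>u \<tau> $ 2 * u \<tau> $ 3\<bar> \<le> c\<^sup>2 * exp (2 * \<tau>)"
      using abs_prod_le_of_sum_squares[OF c[of \<tau>]] by (simp add: exp_double power_mult_distrib)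
  qed
  define m where "m t = u t $ 1 + G t" for t
  have G0: "0 \<le> G t" for t by (simp add: G_def)
  have "mono m"
  proof (rule monoI)
    show "m s \<le> m t" if "s \<le> t" for s t
      using le[OF that] unfolding m_def by linarith
  qed
  moreover have "bdd_below (range m)"
  proof (rule bdd_belowI2)
    fix t
    \<comment> \<open>The increment bound against time 0 applies to times up to 0; monotonicity
      carries the resulting lower bound to positive times.\<close>
    have "m (min t 0) \<le> m t" using \<open>mono m\<close> by (simp add: monoD)
    moreover have "u 0 $ 1 - G 0 \<le> m (min t 0)"
      using le[of "min t 0" 0] G0[of "min t 0"] by (simp add: m_def)
    ultimately show "u 0 $ 1 - G 0 \<le> m t" by linarith
  qed
  ultimately have m: "(m \<longlongrightarrow> Inf (range m)) at_bot" by (rule mono_tendsto_at_bot)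
  have "((\<lambda>t::real. exp (2 * t)) \<longlongrightarrow> 0) at_bot"
    by (intro filterlim_compose[OF exp_at_bot] filterlim_tendsto_pos_mult_at_bot[OF tendsto_const])
      (auto simp: filterlim_ident)
  then have "(G \<longlongrightarrow> 0) at_bot"
    unfolding G_def[abs_def] by (rule tendsto_mult_right_zero)
  from tendsto_diff[OF m this] have x: "((\<lambda>t. u t $ 1) \<longlongrightarrow> Inf (range m)) at_bot"
    by (simp add: m_def)
  define p :: "real ^ 3" where "p = vector [Inf (range m), 0, 0]"
  have "((\<lambda>t. u t $ i) \<longlongrightarrow> p $ i) at_bot" for i
    using vfield_transverse_tendsto[OF c, of i] x exhaust_3[of i] by (auto simp: p_def)
  then have "converges_backward J u p"
    by (simp add: converges_backward_def J vec_tendstoI)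
  moreover have "p \<in> x_axis" by (simp add: p_def x_axis_def)
  ultimately show ?thesis by blast
qed

text \<open>The distance \<open>c * exp t\<close> from the axis bounds the norm from below, and
  \<open>c = 0\<close> would put the whole orbit on the axis. The growth rate is the same for every
  \<open>a\<close>, so the cases \<open>a = 0\<close> and \<open>a < 0\<close> are covered
  together.\<close>

lemma vfield_escapes:
  assumes u: "maximal_solution (vfield a) J u" and "\<not> u ` J \<subseteq> x_axis"
  shows "escapes_forward J u"
proof -
  have J: "J = UNIV" using u by (rule vfield_maximal_global)
  have sol: "ode_solution (vfield a) UNIV u" using u J by (simp add: maximal_solution_def)
  obtain c where c: "c \<ge> 0" "\<And>t. (u t $ 2)\<^sup>2 + (u t $ 3)\<^sup>2 = (c * exp t)\<^sup>2"
    using vfield_radius[OF sol] by blast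
  have "c \<noteq> 0"
  proof
    assume "c = 0"
    then have "u t \<in> x_axis" for t using c(2)[of t] by (simp add: x_axis_def)
    then show False using assms(2) by blast
  qed
  then have "filterlim (\<lambda>t. c * exp t) at_top at_top"
    using c(1) by (intro filterlim_tendsto_pos_mult_at_top[OF tendsto_const] exp_at_top) auto
  then have "filterlim (\<lambda>t. norm (u t)) at_top at_top"
    by (rule filterlim_at_top_mono) (use norm_ge_radius[OF c(2)] in auto)
  then show ?thesis by (simp add: escapes_forward_def J)
qed

section \<open>Fixed points, stable manifold and linearization\<close>

text \<open>The same cancellation as for the distance from the axis: multiplying the last two
  components by \<open>y\<close> and \<open>z\<close> and adding gives
  \<open>y\<^sup>2 + z\<^sup>2 = 0\<close>.\<close>

lemma vfield_fixed_point_iff: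
  "fixed_point (vfield a) p \<longleftrightarrow> a * p $ 1 = 0 \<and> p $ 2 = 0 \<and> p $ 3 = 0"
proof
  assume "fixed_point (vfield a) p"
  then have v: "vfield a p $ i = 0" for i by (simp add: fixed_point_def)
  have "(p $ 2)\<^sup>2 + (p $ 3)\<^sup>2 = p $ 2 * vfield a p $ 2 + p $ 3 * vfield a p $ 3"
    by (simp add: algebra_simps power2_eq_square)
  also have "\<dots> = 0" by (simp only: v)
  finally have "p $ 2 = 0" "p $ 3 = 0" by (simp_all add: sum_power2_eq_zero_iff)
  then show "a * p $ 1 = 0 \<and> p $ 2 = 0 \<and> p $ 3 = 0" using v[of 1] by simp
next
  assume "a * p $ 1 = 0 \<and> p $ 2 = 0 \<and> p $ 3 = 0"
  then show "fixed_point (vfield a) p"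
    by (simp add: fixed_point_def vec_eq_iff forall_3)
qed

lemma vfield_unique_fixed_point:
  assumes "a \<noteq> 0"
  shows "fixed_point (vfield a) p \<longleftrightarrow> p = 0"
  using assms by (simp add: vfield_fixed_point_iff vec_eq_iff forall_3)

text \<open>On the axis the system reduces to the linear equation \<open>x' = a * x\<close>. A
  solution defined for all times is maximal because its domain cannot grow.\<close>

lemma vfield_axis_solution:
  assumes "q \<in> x_axis"
  shows "maximal_solution (vfield a) UNIV (\<lambda>t. exp (a * t) *\<^sub>R q)"
proof -
  have "((\<lambda>t. exp (a * t) *\<^sub>R q) has_vector_derivative vfield a (exp (a * t) *\<^sub>R q)) (at t)" for t
  proof -
    have "vfield a (exp (a * t) *\<^sub>R q) = (exp (a * t) * a) *\<^sub>R q"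
      using assms by (simp add: vec_eq_iff forall_3 x_axis_def)
    then show ?thesis
      by (auto intro!: derivative_eq_intros simp: has_real_derivative_iff_has_vector_derivative[symmetric])
  qed
  then show ?thesis by (auto simp: maximal_solution_def ode_solution_def)
qed

text \<open>An orbit that leaves the axis has norm tending to infinity and cannot converge to 0; the
  explicit orbits on the axis do so because \<open>a < 0\<close>.\<close>

lemma vfield_stable_manifold:
  assumes "a < 0"
  shows "stable_manifold (vfield a) 0 = x_axis"
proof
  show "stable_manifold (vfield a) 0 \<subseteq> x_axis"
  proof
    fix q assume "q \<in> stable_manifold (vfield a) 0"
    then obtain J u where u: "maximal_solution (vfield a) J u" "q \<in> u ` J" "converges_forward J u 0"
      by (auto simp: stable_manifold_def)
    have n: "((\<lambda>t. norm (u t)) \<longlongrightarrow> 0) at_top"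
      using u(3) tendsto_norm_zero by (auto simp: converges_forward_def)
    have "\<not> filterlim (\<lambda>t. norm (u t)) at_top at_top"
      using n not_tendsto_and_filterlim_at_infinity[OF _ n] filterlim_at_top_imp_at_infinity by auto
    then show "q \<in> x_axis" using vfield_escapes[OF u(1)] u(2) by (auto simp: escapes_forward_def)
  qed
  show "x_axis \<subseteq> stable_manifold (vfield a) 0"
  proof
    fix q assume q: "q \<in> x_axis"
    let ?u = "\<lambda>t. exp (a * t) *\<^sub>R q"
    have "((\<lambda>t. exp (a * t)) \<longlongrightarrow> 0) at_top"
      using \<open>a < 0\<close> by (intro filterlim_compose[OF exp_at_bot] filterlim_tendsto_neg_mult_at_bot[OF tendsto_const])
        (auto simp: filterlim_ident)
    from tendsto_scaleR[OF this tendsto_const[of q]] have "(?u \<longlongrightarrow> 0) at_top"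
      by simp
    then have "converges_forward UNIV ?u 0" by (simp add: converges_forward_def)
    moreover have "q \<in> range ?u" by (rule range_eqI[of _ _ 0]) simp
    ultimately show "q \<in> stable_manifold (vfield a) 0"
      using vfield_axis_solution[OF q] by (auto simp: stable_manifold_def)
  qed
qed

text \<open>From this form the subspace property and the dimension 1 of the stable manifold are read
  off.\<close>

lemma x_axis_eq_span: "x_axis = span {axis 1 1}"
proof -
  have "p \<in> x_axis \<longleftrightarrow> (\<exists>k. p = k *\<^sub>R axis 1 1)" for p
    by (simp add: x_axis_def vec_eq_iff forall_3 axis_def)
  then show ?thesis by (auto simp: span_singleton)
qed

lemma vfield_has_derivative_zero:
  "(vfield a has_derivative (\<lambda>h. vector [a * h $ 1, h $ 2, h $ 3])) (at 0)"
proof -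
  \<comment> \<open>Expanding along the basis vectors turns the field into sums and products of
    coordinates, to which the differentiation rules apply; the quadratic terms contribute nothing at
    the origin.\<close>
  let ?V = "\<lambda>p :: real ^ 3. (a * p $ 1 + p $ 2 * p $ 3) *\<^sub>R axis 1 1 + (p $ 2 + p $ 1 * p $ 3) *\<^sub>R axis 2 1 
     + (p $ 3 - p $ 1 * p $ 2) *\<^sub>R (axis 3 1 :: real ^ 3)"
  have nth: "((\<lambda>p. p $ i) has_derivative (\<lambda>h. h $ i)) (at x)" for i :: 3 and x :: "real ^ 3"
    by (rule bounded_linear_imp_has_derivative) (rule bounded_linear_vec_nth)
  have "vfield a = ?V"
    by (rule ext) (simp add: vec_eq_iff forall_3 axis_def)
  moreover have "(?V has_derivative (\<lambda>h. vector [a * h $ 1, h $ 2, h $ 3])) (at 0)"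
    by (rule has_derivative_eq_rhs, (rule has_derivative_add has_derivative_diff has_derivative_scaleR_left
          has_derivative_mult_right has_derivative_mult nth)+)
      (simp add: fun_eq_iff vec_eq_iff forall_3 axis_def)
  ultimately show ?thesis by simp
qed

text \<open>The linearization is the diagonal matrix with entries \<open>a\<close>, 1, 1. Some
  coordinate of an eigenvector is nonzero, and the corresponding row forces the eigenvalue to be
  \<open>a\<close> or 1.\<close>

lemma vfield_hyperbolic:
  assumes "a \<noteq> 0"
  shows "hyperbolic_fixed_point (vfield a) 0"
proof -
  define A where "A = matrix (frechet_derivative (vfield a) (at 0))"
  have fd: "frechet_derivative (vfield a) (at 0) = (\<lambda>h. vector [a * h $ 1, h $ 2, h $ 3])"
    using frechet_derivative_at[OF vfield_has_derivative_zero] by simp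
  have "Re l \<noteq> 0" if l: "complex_eigenvalue A l" for l
  proof -
    obtain v :: "complex ^ 3" where v: "v \<noteq> 0"
      "(\<chi> i j. complex_of_real (A $ i $ j)) *v v = l *s v"
      using l by (auto simp: complex_eigenvalue_def)
    have "(\<Sum>j\<in>UNIV. complex_of_real (A $ i $ j) * v $ j) = l * v $ i" for i
      using arg_cong[OF v(2), of "\<lambda>w. w $ i"] by (simp add: matrix_vector_mult_def)
    from this[of 1] this[of 2] this[of 3]
    have "of_real a * v $ 1 = l * v $ 1" "v $ 2 = l * v $ 2" "v $ 3 = l * v $ 3"
      by (simp_all add: A_def fd matrix_def sum_3 axis_def)
    moreover have "v $ 1 \<noteq> 0 \<or> v $ 2 \<noteq> 0 \<or> v $ 3 \<noteq> 0"
      using v(1) by (auto simp: vec_eq_iff forall_3)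
    ultimately have "l = of_real a \<or> l = 1" by auto
    then show ?thesis using assms by auto
  qed
  then show ?thesis
    using vfield_unique_fixed_point[OF assms] differentiableI[OF vfield_has_derivative_zero]
    by (simp add: hyperbolic_fixed_point_def A_def)
qed

theorem mainTheorem4:
  fixes a :: real
  shows "(a > 0 \<longrightarrow>
            (\<exists>!p. fixed_point (vfield a) p) \<and> fixed_point (vfield a) 0 \<and>
            globally_repelling (vfield a) 0)
       \<and> (a = 0 \<longrightarrow>
            (\<forall>p\<in>x_axis. fixed_point (vfield a) p) \<and>
            (\<forall>J u. maximal_solution (vfield a) J u \<and> \<not> u ` J \<subseteq> x_axis \<longrightarrow>
               (\<exists>p\<in>x_axis. converges_backward J u p) \<and> escapes_forward J u))
       \<and> (a < 0 \<longrightarrow>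
            (\<exists>!p. fixed_point (vfield a) p) \<and> fixed_point (vfield a) 0 \<and>
            hyperbolic_fixed_point (vfield a) 0 \<and>
            stable_manifold (vfield a) 0 = x_axis \<and>
            subspace (stable_manifold (vfield a) 0) \<and> dim (stable_manifold (vfield a) 0) = 1 \<and>
            (\<forall>J u. maximal_solution (vfield a) J u \<and> \<not> u ` J \<subseteq> x_axis \<longrightarrow>
               escapes_forward J u))"
proof (intro conjI impI)
  assume "a > 0"
  then show "\<exists>!p. fixed_point (vfield a) p" "fixed_point (vfield a) 0"
    by (simp_all add: vfield_unique_fixed_point)
  with \<open>a > 0\<close> show "globally_repelling (vfield a) 0"
    by (simp add: globally_repelling_def vfield_repelling)
next
  assume "a = 0"
  then show "\<forall>p\<in>x_axis. fixed_point (vfield a) p"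
    by (simp add: vfield_fixed_point_iff x_axis_def)
  show "\<forall>J u. maximal_solution (vfield a) J u \<and> \<not> u ` J \<subseteq> x_axis \<longrightarrow>
      (\<exists>p\<in>x_axis. converges_backward J u p) \<and> escapes_forward J u"
    using \<open>a = 0\<close> vfield_zero_converges_backward vfield_escapes by blast
next
  assume a: "a < 0"
  then show "\<exists>!p. fixed_point (vfield a) p" "fixed_point (vfield a) 0"
    by (simp_all add: vfield_unique_fixed_point)
  show "hyperbolic_fixed_point (vfield a) 0" using a by (simp add: vfield_hyperbolic)
  show "stable_manifold (vfield a) 0 = x_axis" using a by (rule vfield_stable_manifold)
  then show "subspace (stable_manifold (vfield a) 0)" "dim (stable_manifold (vfield a) 0) = 1"
    by (simp_all add: x_axis_eq_span)
  show "\<forall>J u. maximal_solution (vfield a) J u \<and> \<not> u ` J \<subseteq> x_axis \<longrightarrow> escapes_forward J u"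
    using vfield_escapes by blast
qed

end
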